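(* Let $(X_1,d_1)$ and $(X_2,d_2)$ be metric spaces, let $\psi\in\mathbf{\Psi}_2$, and let $X:=X_1\times X_2$ be equipped with the metric $d_\psi$. Let $T:X\to X$ be given by $T(x_1,x_2):=(T_1(x_1,x_2),T_2(x_1,x_2))$ for all $(x_1,x_2)\in X$, where $T_1:X\to X_1$ and $T_2:X\to X_2$. Let $$\lambda:=2\psi\left(\tfrac12,\tfrac12\right),\qquad \theta:=(1+\lambda)\,\psi\left(\frac{\lambda}{\lambda+1},\frac{1}{\lambda+1}\right).$$ Suppose that the following conditions are satisfied: (i) $X_1$ has the fixed point property for strictly contractive maps; (ii) $X_2$ has the fixed point property for Lipschitz continuous maps with constant $\theta$; (iii) $T$ is a nonexpansive map (with respect to $d_\psi$) satisfying $$d_1(T_1(x_1,x_2),T_1(x'_1,x'_2))<\frac{\lambda}{\theta}\cdot d_\psi((x_1,x_2),(x'_1,x'_2))$$ for all $(x_1,x_2),(x'_1,x'_2)\in X$ with $d_1(x_1,x'_1)>\lambda\, d_2(x_2,x'_2)$. Then $T$ has a fixed point.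
   Context: Let $\Omega_2:=\{(t_1,t_2)\in\mathbb{R}^2 \mid t_1,t_2\ge 0,\ t_1+t_2=1\}$. The class $\mathbf{\Psi}_2$ consists of all continuous convex functions $\psi:\Omega_2\to\mathbb{R}$ with $\psi(1,0)=\psi(0,1)=1$ such that for all $(t_1,t_2)\in\Omega_2$: $\psi(t_1,t_2)\ge(1-t_1)\,\psi\left(0,\frac{t_2}{1-t_1}\right)$ if $t_1<1$, and $\psi(t_1,t_2)\ge(1-t_2)\,\psi\left(\frac{t_1}{1-t_2},0\right)$ if $t_2<1$. For metric spaces $(X_1,d_1)$, $(X_2,d_2)$ and $\psi\in\mathbf{\Psi}_2$, the metric $d_\psi$ on $X_1\times X_2$ is defined by $d_\psi(x,y):=0$ if $x=y$ and, for $x=(x_1,x_2)\ne y=(y_1,y_2)$, with $D:=d_1(x_1,y_1)+d_2(x_2,y_2)$, $$d_\psi(x,y):=D\cdot\psi\left(\frac{d_1(x_1,y_1)}{D},\frac{d_2(x_2,y_2)}{D}\right).$$ A map $f:X\to Y$ between metric spaces is Lipschitz continuous with constant $\theta>0$ if $d(f(x),f(x'))\le\theta\, d(x,x')$ for all $x,x'\in X$; nonexpansive if this holds with $\theta=1$; strictly contractive if $d(f(x),f(x'))<d(x,x')$ for all $x,x'\in X$ with $x\ne x'$. A metric space has the fixed point property for a property $P$ if every self-map of the space possessing property $P$ admits a fixed point (a point $\bar x$ with $f(\bar x)=\bar x$). *)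

theory Defs
  imports "HOL-Analysis.Analysis"
begin

definition Omega2 :: "(real \<times> real) set" where
  "Omega2 = {(t1, t2). 0 \<le> t1 \<and> 0 \<le> t2 \<and> t1 + t2 = 1}"

text \<open>Members of \<open>Psi2\<close> are total functions, but only their values on \<^const>\<open>Omega2\<close> are
  constrained.\<close>

definition Psi2 :: "(real \<times> real \<Rightarrow> real) set" where
  "Psi2 = {\<psi>. continuous_on Omega2 \<psi> \<and> convex_on Omega2 \<psi> \<and>
     \<psi> (1, 0) = 1 \<and> \<psi> (0, 1) = 1 \<and>
     (\<forall>(t1, t2) \<in> Omega2.
        (t1 < 1 \<longrightarrow> \<psi> (t1, t2) \<ge> (1 - t1) * \<psi> (0, t2 / (1 - t1))) \<and>
        (t2 < 1 \<longrightarrow> \<psi> (t1, t2) \<ge> (1 - t2) * \<psi> (t1 / (1 - t2), 0)))}"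

definition d_psi ::
  "(real \<times> real \<Rightarrow> real) \<Rightarrow> ('a \<Rightarrow> 'a \<Rightarrow> real) \<Rightarrow> ('b \<Rightarrow> 'b \<Rightarrow> real) \<Rightarrow>
   'a \<times> 'b \<Rightarrow> 'a \<times> 'b \<Rightarrow> real" where
  "d_psi \<psi> d1 d2 x y =
     (if x = y then 0
      else let D = d1 (fst x) (fst y) + d2 (snd x) (snd y)
           in D * \<psi> (d1 (fst x) (fst y) / D, d2 (snd x) (snd y) / D))"

text \<open>Metric spaces are given by a carrier and a distance function, as in the locale
  \<^locale>\<open>Metric_space\<close>; the properties of maps below depend only on values on the carrier.\<close>

definition lipschitz_with ::
  "real \<Rightarrow> 'a set \<Rightarrow> ('a \<Rightarrow> 'a \<Rightarrow> real) \<Rightarrow> 'b set \<Rightarrow> ('b \<Rightarrow> 'b \<Rightarrow> real) \<Rightarrow> ('a \<Rightarrow> 'b) \<Rightarrow> bool" where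
  "lipschitz_with C X d Y d' f \<longleftrightarrow>
     0 < C \<and> f \<in> X \<rightarrow> Y \<and> (\<forall>x\<in>X. \<forall>x'\<in>X. d' (f x) (f x') \<le> C * d x x')"

definition nonexpansive ::
  "'a set \<Rightarrow> ('a \<Rightarrow> 'a \<Rightarrow> real) \<Rightarrow> 'b set \<Rightarrow> ('b \<Rightarrow> 'b \<Rightarrow> real) \<Rightarrow> ('a \<Rightarrow> 'b) \<Rightarrow> bool" where
  "nonexpansive X d Y d' f \<longleftrightarrow> lipschitz_with 1 X d Y d' f"

definition strictly_contractive ::
  "'a set \<Rightarrow> ('a \<Rightarrow> 'a \<Rightarrow> real) \<Rightarrow> 'b set \<Rightarrow> ('b \<Rightarrow> 'b \<Rightarrow> real) \<Rightarrow> ('a \<Rightarrow> 'b) \<Rightarrow> bool" where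
  "strictly_contractive X d Y d' f \<longleftrightarrow>
     f \<in> X \<rightarrow> Y \<and> (\<forall>x\<in>X. \<forall>x'\<in>X. x \<noteq> x' \<longrightarrow> d' (f x) (f x') < d x x')"

definition fixed_point_property :: "'a set \<Rightarrow> (('a \<Rightarrow> 'a) \<Rightarrow> bool) \<Rightarrow> bool" where
  "fixed_point_property X P \<longleftrightarrow> (\<forall>f. f \<in> X \<rightarrow> X \<and> P f \<longrightarrow> (\<exists>x\<in>X. f x = x))"

end

theory Submission
  imports Defs
begin

text \<open>
  The function \<open>\<psi>\<close> is the restriction to the unit simplex of a homogeneous function \<open>N\<close> on
  the quadrant, \<open>N (a, b) = (a + b) \<psi> (a / (a + b), b / (a + b))\<close> (\<open>psi_gauge\<close> below), and \<open>d\<^sub>\<psi>\<close> is \<open>N\<close> applied to the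
  two coordinate distances. Convexity of \<open>\<psi>\<close> becomes subadditivity of \<open>N\<close>, and the lower bounds
  in the definition of the class become \<open>max a b \<le> N (a, b)\<close>. Together they make \<open>N\<close> monotone
  in each argument (lemma \<open>psi_gauge_mono\<close>). In terms of \<open>N\<close> the two constants are
  \<open>\<lambda> = N (1, 1)\<close> and \<open>\<theta> = N (\<lambda>, 1)\<close>; in particular \<open>0 < \<lambda> \<le> \<theta>\<close>.

  The fixed point is found one coordinate at a time. With the second coordinate \<open>y\<close> held fixed,
  condition (iii) makes \<open>x \<mapsto> T\<^sub>1 (x, y)\<close> strictly contractive, because
  \<open>d\<^sub>\<psi>\<close> reduces to \<open>d\<^sub>1\<close> and \<open>\<lambda> / \<theta> \<le> 1\<close>; let \<open>f y\<close> be its fixed point. A fixed point \<open>y\<close> of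
  \<open>g y = T\<^sub>2 (f y, y)\<close> then yields the fixed point \<open>(f y, y)\<close> of \<open>T\<close>, so it remains to see that
  \<open>g\<close> is Lipschitz with constant \<open>\<theta>\<close>.

  The map \<open>f\<close> is Lipschitz with constant \<open>\<lambda>\<close>: put \<open>a = d\<^sub>1 (f y, f y')\<close> and
  \<open>b = d\<^sub>2 (y, y')\<close>. If \<open>a > \<lambda> b\<close>, then monotonicity and homogeneity give
  \<open>N (a, b) \<le> N (a, a / \<lambda>) = (a / \<lambda>) \<theta>\<close>, while \<open>f y\<close> and \<open>f y'\<close> are values of \<open>T\<^sub>1\<close>, so that (iii)
  gives \<open>a < (\<lambda> / \<theta>) N (a, b) \<le> a\<close>, which is absurd. Hence \<open>a \<le> \<lambda> b\<close>, and nonexpansiveness of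
  \<open>T\<close> gives \<open>d\<^sub>2 (g y, g y') \<le> N (a, b) \<le> N (\<lambda> b, b) = \<theta> b\<close>.
\<close>

definition psi_gauge :: "(real \<times> real \<Rightarrow> real) \<Rightarrow> real \<Rightarrow> real \<Rightarrow> real" where
  "psi_gauge \<psi> a b = (a + b) * \<psi> (a / (a + b), b / (a + b))"

lemma psi_gauge_zero_zero [simp]: "psi_gauge \<psi> 0 0 = 0"
  by (simp add: psi_gauge_def)

lemma psi_gauge_axes:
  assumes "\<psi> \<in> Psi2"
  shows "psi_gauge \<psi> a 0 = a" and "psi_gauge \<psi> 0 b = b"
  using assms by (cases "a = 0"; cases "b = 0"; simp add: psi_gauge_def Psi2_def)+

lemma psi_gauge_scale:
  assumes "c > 0"
  shows "psi_gauge \<psi> (c * a) (c * b) = c * psi_gauge \<psi> a b"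
proof -
  have "c * a + c * b = c * (a + b)" by (simp add: algebra_simps)
  then show ?thesis using assms by (simp add: psi_gauge_def)
qed

lemma Omega2_normalized:
  assumes "0 \<le> a" "0 \<le> b" "0 < a + b"
  shows "(a / (a + b), b / (a + b)) \<in> Omega2"
  using assms by (simp add: Omega2_def add_divide_distrib [symmetric])

text \<open>The normalization of a sum of two points is the convex combination of their normalizations
  with weights proportional to the coordinate sums, so that convexity of \<open>\<psi>\<close> is subadditivity
  of its homogeneous extension.\<close>

lemma psi_gauge_subadditive:
  assumes \<psi>: "\<psi> \<in> Psi2" and nn: "0 \<le> a" "0 \<le> b" "0 \<le> c" "0 \<le> d"
  shows "psi_gauge \<psi> (a + c) (b + d) \<le> psi_gauge \<psi> a b + psi_gauge \<psi> c d"
proof (cases "a + b = 0 \<or> c + d = 0")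
  case True
  then have "(a = 0 \<and> b = 0) \<or> (c = 0 \<and> d = 0)" using nn by linarith
  then show ?thesis by auto
next
  case False
  define D where "D = (a + b) + (c + d)"
  have pos: "0 < a + b" "0 < c + d" "0 < D" using False nn by (auto simp: D_def)
  define u where "u = (a + b) / D"
  define v where "v = (c + d) / D"
  have uv: "u \<ge> 0" "v \<ge> 0" "u + v = 1"
    using pos by (auto simp: u_def v_def add_divide_distrib [symmetric] D_def)
  define p where "p = (a / (a + b), b / (a + b))"
  define q where "q = (c / (c + d), d / (c + d))"
  have mem: "p \<in> Omega2" "q \<in> Omega2"
    using nn pos by (simp_all add: p_def q_def Omega2_normalized)
  have "convex_on Omega2 \<psi>" using \<psi> by (simp add: Psi2_def)
  then have "\<psi> (u *\<^sub>R p + v *\<^sub>R q) \<le> u * \<psi> p + v * \<psi> q"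
    using mem uv unfolding convex_on_def by blast
  moreover have "u *\<^sub>R p + v *\<^sub>R q = ((a + c) / D, (b + d) / D)"
  proof -
    have "u * (a / (a + b)) = a / D" "u * (b / (a + b)) = b / D"
      "v * (c / (c + d)) = c / D" "v * (d / (c + d)) = d / D"
      using pos by (simp_all add: u_def v_def)
    then show ?thesis by (simp add: p_def q_def add_divide_distrib)
  qed
  ultimately have "D * \<psi> ((a + c) / D, (b + d) / D) \<le> D * (u * \<psi> p + v * \<psi> q)"
    using pos by simp
  also have "\<dots> = (a + b) * \<psi> p + (c + d) * \<psi> q"
    using pos by (simp add: u_def v_def distrib_left)
  finally show ?thesis
    by (simp add: psi_gauge_def p_def q_def D_def algebra_simps)
qed

lemma psi_gauge_ge:
  assumes \<psi>: "\<psi> \<in> Psi2" and nn: "0 \<le> a" "0 \<le> b"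
  shows "a \<le> psi_gauge \<psi> a b" and "b \<le> psi_gauge \<psi> a b"
proof -
  have norm: "\<psi> (1, 0) = 1" "\<psi> (0, 1) = 1" using \<psi> by (auto simp: Psi2_def)
  have simplex: "s \<le> \<psi> (s, t) \<and> t \<le> \<psi> (s, t)" if st: "(s, t) \<in> Omega2" for s t
  proof -
    have eq: "1 - s = t" "1 - t = s" using st by (auto simp: Omega2_def)
    have "s < 1 \<longrightarrow> (1 - s) * \<psi> (0, t / (1 - s)) \<le> \<psi> (s, t)"
      and "t < 1 \<longrightarrow> (1 - t) * \<psi> (s / (1 - t), 0) \<le> \<psi> (s, t)"
      using \<psi> st unfolding Psi2_def by fastforce+
    then show ?thesis
      using st norm unfolding eq
      by (cases "s = 0"; cases "t = 0") (auto simp: Omega2_def)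
  qed
  have "a \<le> psi_gauge \<psi> a b \<and> b \<le> psi_gauge \<psi> a b"
  proof (cases "a + b = 0")
    case True
    then show ?thesis using nn by (simp add: psi_gauge_def)
  next
    case False
    then have pos: "0 < a + b" using nn by simp
    show ?thesis
      using simplex [OF Omega2_normalized [OF nn pos]] pos
      by (simp add: psi_gauge_def pos_divide_le_eq mult.commute)
  qed
  then show "a \<le> psi_gauge \<psi> a b" and "b \<le> psi_gauge \<psi> a b" by auto
qed

text \<open>A point \<open>(a, b)\<close> with \<open>0 \<le> b \<le> b'\<close> lies on the segment from \<open>(a, 0)\<close> to \<open>(a, b')\<close>, on which
  a convex function is bounded by its larger end value. That is the value at \<open>(a, b')\<close>, since
  the value at \<open>(a, 0)\<close> is \<open>a\<close>.\<close>

lemma psi_gauge_mono_right: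
  assumes \<psi>: "\<psi> \<in> Psi2" and nn: "0 \<le> a" "0 \<le> b" and le: "b \<le> b'"
  shows "psi_gauge \<psi> a b \<le> psi_gauge \<psi> a b'"
proof (cases "b = 0 \<or> b = b'")
  case True
  then show ?thesis using psi_gauge_ge(1) [OF \<psi>, of a b'] nn le
    by (auto simp: psi_gauge_axes [OF \<psi>])
next
  case False
  define s where "s = b / b'"
  have s: "0 < s" "s \<le> 1" "s * b' = b" using False nn le by (auto simp: s_def)
  have "psi_gauge \<psi> a b = psi_gauge \<psi> ((1 - s) * a + s * a) (0 + s * b')"
    using s by (simp add: algebra_simps)
  also have "\<dots> \<le> psi_gauge \<psi> ((1 - s) * a) 0 + psi_gauge \<psi> (s * a) (s * b')"
    using nn s by (intro psi_gauge_subadditive [OF \<psi>]) auto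
  also have "\<dots> = (1 - s) * a + s * psi_gauge \<psi> a b'"
    using s(1) by (simp add: psi_gauge_axes [OF \<psi>] psi_gauge_scale)
  also have "\<dots> \<le> (1 - s) * psi_gauge \<psi> a b' + s * psi_gauge \<psi> a b'"
    using psi_gauge_ge(1) [OF \<psi>, of a b'] nn le s by (intro add_mono mult_left_mono) auto
  finally show ?thesis by (simp add: algebra_simps)
qed

lemma psi_gauge_mono_left:
  assumes \<psi>: "\<psi> \<in> Psi2" and nn: "0 \<le> a" "0 \<le> b" and le: "a \<le> a'"
  shows "psi_gauge \<psi> a b \<le> psi_gauge \<psi> a' b"
proof (cases "a = 0 \<or> a = a'")
  case True
  then show ?thesis using psi_gauge_ge(2) [OF \<psi>, of a' b] nn le
    by (auto simp: psi_gauge_axes [OF \<psi>])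
next
  case False
  define s where "s = a / a'"
  have s: "0 < s" "s \<le> 1" "s * a' = a" using False nn le by (auto simp: s_def)
  have "psi_gauge \<psi> a b = psi_gauge \<psi> (0 + s * a') ((1 - s) * b + s * b)"
    using s by (simp add: algebra_simps)
  also have "\<dots> \<le> psi_gauge \<psi> 0 ((1 - s) * b) + psi_gauge \<psi> (s * a') (s * b)"
    using nn le s by (intro psi_gauge_subadditive [OF \<psi>]) auto
  also have "\<dots> = (1 - s) * b + s * psi_gauge \<psi> a' b"
    using s(1) by (simp add: psi_gauge_axes [OF \<psi>] psi_gauge_scale)
  also have "\<dots> \<le> (1 - s) * psi_gauge \<psi> a' b + s * psi_gauge \<psi> a' b"
    using psi_gauge_ge(2) [OF \<psi>, of a' b] nn le s by (intro add_mono mult_left_mono) auto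
  finally show ?thesis by (simp add: algebra_simps)
qed

lemma psi_gauge_mono:
  assumes "\<psi> \<in> Psi2" "0 \<le> a" "0 \<le> b" "a \<le> a'" "b \<le> b'"
  shows "psi_gauge \<psi> a b \<le> psi_gauge \<psi> a' b'"
  using psi_gauge_mono_left [of \<psi> a b a'] psi_gauge_mono_right [of \<psi> a' b b'] assms by linarith

lemma d_psi_eq_psi_gauge:
  assumes "Metric_space X1 d1" "Metric_space X2 d2" "x \<in> X1 \<times> X2"
  shows "d_psi \<psi> d1 d2 x y = psi_gauge \<psi> (d1 (fst x) (fst y)) (d2 (snd x) (snd y))"
proof -
  have "d1 (fst x) (fst x) = 0" "d2 (snd x) (snd x) = 0"
    using assms by (auto simp: Metric_space.zero)
  then show ?thesis by (auto simp: d_psi_def psi_gauge_def Let_def)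
qed

theorem theorem4p1:
  fixes X1 :: "'a set" and d1 :: "'a \<Rightarrow> 'a \<Rightarrow> real"
    and X2 :: "'b set" and d2 :: "'b \<Rightarrow> 'b \<Rightarrow> real"
    and \<psi> :: "real \<times> real \<Rightarrow> real"
    and T :: "'a \<times> 'b \<Rightarrow> 'a \<times> 'b"
    and T1 :: "'a \<times> 'b \<Rightarrow> 'a" and T2 :: "'a \<times> 'b \<Rightarrow> 'b"
    and lam \<theta> :: real
  assumes "Metric_space X1 d1" and "Metric_space X2 d2"
    and "\<psi> \<in> Psi2"
    and "T1 \<in> X1 \<times> X2 \<rightarrow> X1" and "T2 \<in> X1 \<times> X2 \<rightarrow> X2"
    and "\<forall>x1\<in>X1. \<forall>x2\<in>X2. T (x1, x2) = (T1 (x1, x2), T2 (x1, x2))"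
    and "lam = 2 * \<psi> (1 / 2, 1 / 2)"
    and "\<theta> = (1 + lam) * \<psi> (lam / (lam + 1), 1 / (lam + 1))"
    and "fixed_point_property X1 (strictly_contractive X1 d1 X1 d1)"
    and "fixed_point_property X2 (lipschitz_with \<theta> X2 d2 X2 d2)"
    and "nonexpansive (X1 \<times> X2) (d_psi \<psi> d1 d2) (X1 \<times> X2) (d_psi \<psi> d1 d2) T"
    and "\<forall>x1\<in>X1. \<forall>x2\<in>X2. \<forall>x1'\<in>X1. \<forall>x2'\<in>X2. d1 x1 x1' > lam * d2 x2 x2' \<longrightarrow>
           d1 (T1 (x1, x2)) (T1 (x1', x2')) < lam / \<theta> * d_psi \<psi> d1 d2 (x1, x2) (x1', x2')"
  shows "\<exists>x\<in>X1 \<times> X2. T x = x"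
proof -
  interpret M1: Metric_space X1 d1 by fact
  interpret M2: Metric_space X2 d2 by fact
  note \<psi> = \<open>\<psi> \<in> Psi2\<close>
  note T1 = \<open>T1 \<in> X1 \<times> X2 \<rightarrow> X1\<close> and T2 = \<open>T2 \<in> X1 \<times> X2 \<rightarrow> X2\<close>
  note T = assms(6)
  let ?N = "psi_gauge \<psi>"
  have dist: "d_psi \<psi> d1 d2 (x, y) z = ?N (d1 x (fst z)) (d2 y (snd z))"
    if "x \<in> X1" "y \<in> X2" for x y z
    using d_psi_eq_psi_gauge [of X1 d1 X2 d2 "(x, y)"] that M1.Metric_space_axioms
      M2.Metric_space_axioms by simp

  have lam_eq: "lam = ?N 1 1" using assms(7) by (simp add: psi_gauge_def)
  have theta_eq: "\<theta> = ?N lam 1" using assms(8) by (simp add: psi_gauge_def add.commute)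
  have lam_pos: "0 < lam" using psi_gauge_ge(1) [OF \<psi>, of 1 1] lam_eq by simp
  have lam_le_theta: "lam \<le> \<theta>" using psi_gauge_ge(1) [OF \<psi>, of lam 1] theta_eq lam_pos by simp
  have theta_pos: "0 < \<theta>" using lam_pos lam_le_theta by simp

  have gap: "d1 (T1 (x, y)) (T1 (x', y')) < lam / \<theta> * ?N (d1 x x') (d2 y y')"
    if "x \<in> X1" "y \<in> X2" "x' \<in> X1" "y' \<in> X2" "lam * d2 y y' < d1 x x'" for x y x' y'
    using assms(12) [rule_format, OF that] dist [OF that(1,2), of "(x', y')"] by simp

  have "\<exists>x\<in>X1. T1 (x, y) = x" if y: "y \<in> X2" for y
  proof -
    have "d1 (T1 (x, y)) (T1 (x', y)) < d1 x x'"
      if x: "x \<in> X1" "x' \<in> X1" "x \<noteq> x'" for x x'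
    proof -
      have "d1 (T1 (x, y)) (T1 (x', y)) < lam / \<theta> * ?N (d1 x x') 0"
        using gap [OF x(1) y x(2) y] x y by simp
      also have "\<dots> \<le> 1 * d1 x x'"
        unfolding psi_gauge_axes(1) [OF \<psi>]
        using lam_le_theta theta_pos by (intro mult_right_mono) auto
      finally show ?thesis by simp
    qed
    then have "strictly_contractive X1 d1 X1 d1 (\<lambda>x. T1 (x, y))"
      using T1 y by (auto simp: strictly_contractive_def)
    moreover have "(\<lambda>x. T1 (x, y)) \<in> X1 \<rightarrow> X1" using T1 y by auto
    ultimately show ?thesis
      using assms(9) unfolding fixed_point_property_def by blast
  qed
  then obtain f where f: "\<And>y. y \<in> X2 \<Longrightarrow> f y \<in> X1" "\<And>y. y \<in> X2 \<Longrightarrow> T1 (f y, y) = f y"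
    by metis

  have f_lipschitz: "d1 (f y) (f y') \<le> lam * d2 y y'" if y: "y \<in> X2" "y' \<in> X2" for y y'
  proof (rule ccontr)
    define a where "a = d1 (f y) (f y')"
    define b where "b = d2 y y'"
    assume "\<not> ?thesis"
    then have ab: "lam * b < a" by (simp add: a_def b_def)
    moreover have b: "0 \<le> b" by (simp add: b_def)
    ultimately have a: "0 < a" using lam_pos by (smt (verit) mult_nonneg_nonneg)
    have "a < lam / \<theta> * ?N a b"
      using gap [of "f y" y "f y'" y'] f y ab by (simp add: a_def b_def)
    \<comment> \<open>\<open>(a, a / lam)\<close> is \<open>(lam, 1)\<close> scaled by \<open>a / lam\<close>, where the value of \<open>N\<close> is known.\<close>
    also have "\<dots> \<le> lam / \<theta> * ?N (a / lam * lam) (a / lam * 1)"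
      using a b ab lam_pos theta_pos
      by (intro mult_left_mono psi_gauge_mono [OF \<psi>]) (auto simp: field_simps)
    also have "\<dots> = lam / \<theta> * (a / lam * \<theta>)"
      unfolding theta_eq using a lam_pos by (subst psi_gauge_scale) auto
    also have "\<dots> = a" using lam_pos theta_pos by simp
    finally show False by simp
  qed

  define g where "g y = T2 (f y, y)" for y
  have g_in: "g \<in> X2 \<rightarrow> X2" using T2 f by (auto simp: g_def)
  have "d2 (g y) (g y') \<le> \<theta> * d2 y y'" if y: "y \<in> X2" "y' \<in> X2" for y y'
  proof (cases "y = y'")
    case True
    then show ?thesis using y g_in by (auto simp: Pi_iff)
  next
    case False
    then have pos: "0 < d2 y y'" using y by (simp add: M2.mdist_pos_less)
    have "d2 (g y) (g y') \<le> ?N (d1 (f y) (f y')) (d2 (g y) (g y'))"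
      by (intro psi_gauge_ge [OF \<psi>]) auto
    also have "\<dots> = d_psi \<psi> d1 d2 (T (f y, y)) (T (f y', y'))"
      using dist [of "f y" "g y"] T f y g_in by (auto simp: g_def Pi_iff)
    also have "\<dots> \<le> d_psi \<psi> d1 d2 (f y, y) (f y', y')"
      using assms(11) f y by (auto simp: nonexpansive_def lipschitz_with_def)
    also have "\<dots> = ?N (d1 (f y) (f y')) (d2 y y')"
      using dist f y by simp
    also have "\<dots> \<le> ?N (d2 y y' * lam) (d2 y y' * 1)"
      using f_lipschitz y by (intro psi_gauge_mono [OF \<psi>]) (auto simp: mult.commute)
    also have "\<dots> = \<theta> * d2 y y'"
      using psi_gauge_scale [OF pos, of \<psi> lam 1] theta_eq by simp
    finally show ?thesis .
  qed
  then have "lipschitz_with \<theta> X2 d2 X2 d2 g"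
    using theta_pos g_in by (simp add: lipschitz_with_def)
  then obtain y where y: "y \<in> X2" "g y = y"
    using assms(10) g_in unfolding fixed_point_property_def by blast
  then have "T (f y, y) = (f y, y)" using T f by (simp add: g_def)
  then show ?thesis using f y by blast
qed

end
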